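(* The algorithm $\mathcal{A}$ described in the context is correct in the following sense. Let its input be: a series root $\phi$ of $m(X)$ together with a cone $C_0$ containing $\mathrm{recCone}(\mathrm{Newt}(\phi))$; a cone $C_1\subseteq\mathbb{R}^3$ that contains the support of a series $F\in\mathbb{C}[x,y][[t]]$ and satisfies $C_1\cap(\mathbb{R}^2\times\{0\})=\{0\}$, together with a method for computing the coefficient of any term of $F$; and a list $L_0$ of tuples $(p_1(X),p_2(X),p_3(X))$ of polynomials in $X$ over $\mathbb{Q}(x,y)$. If $\mathcal{A}$ returns True on this input, then there is a total order $\preceq$ on $\mathbb{Q}^2$ such that $$[x^{\geq}y^{\geq}]\; p_3(\phi)\,F(p_1(\phi),p_2(\phi)) = 0 \quad\text{in } \mathbb{C}_{\preceq}((x,y))[[t]]$$ for all $(p_1(X),p_2(X),p_3(X))$ in $L_0$.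
   Context: Cones. A subset $C\subseteq\mathbb{R}^n$ is a cone if $\lambda C= C$ for all $\lambda\ge 0$ (so that in particular $0\in C$); it is polyhedral if $C=\mathbb{R}_{\ge0}v_1+\dots+\mathbb{R}_{\ge0}v_k$ for some $v_1,\dots,v_k\in\mathbb{R}^n$, and rational if the $v_i$ can be chosen in $\mathbb{Q}^n$. It is strictly convex if it is convex and $C\cap(-C)=\{0\}$. The dual of $C$ is $C^*=\{u\in\mathbb{R}^n: u\cdot v\le 0\text{ for all }v\in C\}$. The recession cone of $P\subseteq\mathbb{R}^n$ is $\mathrm{recCone}(P)=\{v\in\mathbb{R}^n: P+\mathbb{R}_{\ge0}v\subseteq P\}$. The vertex cone of a polyhedron $P$ at a vertex $v$ is the smallest cone $C$ with $P\subseteq v+C$. Subsets of $\mathbb{R}^2$ are identified with subsets of $\mathbb{R}^2\times\{0\}\subseteq\mathbb{R}^3$ when needed. Series. A series in $\mathbf{x}=(x_1,\dots,x_n)$ over $\mathbb{C}$ is a formal sum $\phi=\sum_{I\in\mathbb{Q}^n}a_I\mathbf{x}^I$ with support $\mathrm{supp}(\phi)=\{I: a_I\ne0\}$, where it is assumed throughout that $\mathrm{supp}(\phi)\subseteq(v+C)\cap\frac1k\mathbb{Z}^n$ for some $v\in\mathbb{R}^n$, some strictly convex rational cone $C$ and some nonzero integer $k$. $\mathrm{Newt}(\phi)$ is the convex hull of $\mathrm{supp}(\phi)$. Total orders on $\mathbb{Q}^n$ are those induced by some $w\in\mathbb{R}^n$ via $\alpha\preceq\beta\iff\alpha\cdot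 w\le\beta\cdot w$. $\mathbb{C}_\preceq((\mathbf{x}))$ is the set of series whose support has a maximal element with respect to $\preceq$; it is an algebraically closed field. For nonzero $g\in\mathbb{C}_\preceq((\mathbf{x}))$, $\mathrm{lt}(g)=\mathrm{lt}_\preceq(g)$ is the term of $g$ with $\preceq$-maximal exponent, and this exponent is the leading exponent. The field $\mathbb{C}(x,y)$ is viewed as a subfield of $\mathbb{C}_\preceq((x,y))$ by identifying $p/q$ with $\frac{p}{\mathrm{lt}_\preceq(q)}\sum_{k\ge0}\bigl(1-\frac{q}{\mathrm{lt}_\preceq(q)}\bigr)^k$. Here $m(X)\in\mathbb{C}(x,y)[X]$ is the minimal polynomial of some element of $\overline{\mathbb{C}(x,y)}$, and a series root $\phi\in\mathbb{C}_\preceq((x,y))$ of $m(X)$ gives an embedding $\mathbb{C}(x,y)[X]/\langle m(X)\rangle\to\mathbb{C}_\preceq((x,y))$, $p(X)+\langle m(X)\rangle\mapsto p(\phi)$. The operator $[x^\ge y^\ge]$ discards all terms of a series in which $x$ or $y$ has a negative exponent. The support of a series in $x,y,t$ is viewed as a set of exponents $(i,j,n)$ of $x^iy^jt^n$. Composition theorem (a known result used by the algorithm). Let $C\subseteq\mathbb{R}^n$ be a strictly convex cone, $F(x_1,\dots,x_n)$ a series with $\mathrm{supp}(F)\subseteq C$, $\preceq$ an additive total order and $g_1,\dots,g_n$ nonzero elements of $\mathbb{C}_\preceq((y_1,\dots,y_m))$. Let $M$ be the $m\times n$ matrix whose $i$-th column is the leading exponent of $g_i$, and let $C'$ be a cone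 that contains the image of $C$ under $M$ and $\mathrm{supp}(g_i/\mathrm{lt}(g_i))$ for all $i$. If $C\cap\ker(M)=\{0\}$ and $C'$ is strictly convex, then $F(g_1,\dots,g_n)$ is well-defined and $\mathrm{supp}(F(g_1,\dots,g_n))\subseteq C'$. It is applied below to $F\in\mathbb{C}[x,y][[t]]$ with $g_1=p_1(\phi)$, $g_2=p_2(\phi)$, $g_3=t$ and $C=C_1$. Algorithm $\mathcal{A}$. Input: as in the claim. Output: True or Failed. Step 1. Determine the maximal list $L_1$ of minimal cones $C\subseteq\mathbb{R}^2$ such that for every polynomial $p(X)$ that appears as a component of an element of $L_0$, its series expansion (i.e. the polynomial in $X$ obtained by expanding its coefficients in $\mathbb{C}_\preceq((x,y))$) depends only on the cone $C$ but not on the specific total order $\preceq$ induced by an element of $C^*$. Step 2. For each $C\in L_1$ such that $C+C_0$ is strictly convex, do steps 3 and 4. Step 3. Choose any total order $\preceq$ on $\mathbb{Q}^2$ induced by some element of $(C+C_0)^*$, and determine for each $p(X)$ that appears as a component of an element of $L_0$ a list $L_p$ of pairs $(v_p,C_{v_p})$ such that $v_p$ is a vertex of the convex hull of the support of $p(\phi)$ in $\mathbb{C}_\preceq((x,y))$ and $C_{v_p}$ is an estimate of the corresponding vertex cone (a strictly convex cone with $\mathrm{supp}(p(\phi))\subseteq v_p+C_{v_p}$). Step 4. If for each $(p_1(X),p_2(X),p_3(X))$ in $L_0$ there are $(v_{p_i},C_{v_{p_i}})\in L_{p_i}$, $i=1,2,3$, such that for the cone $C'$ computed from $C_1$, $(v_{p_1},C_{v_{p_1}})$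 and $(v_{p_2},C_{v_{p_2}})$ using the composition theorem (that is, $v_{p_1},v_{p_2}$ are used as leading exponents of $p_1(\phi),p_2(\phi)$ and $v_{p_i}+C_{v_{p_i}}$ as bounds for their supports, so that $C'$ is a cone as in the theorem containing the image of $C_1$ under the matrix with columns $(v_{p_1},0),(v_{p_2},0),(0,0,1)$ and containing $C_{v_{p_1}},C_{v_{p_2}}$), the set $$\left(\mathbb{Q}_{\ge0}^2\times\mathbb{Q}\right)\cap\left(v_{p_3}+C_{v_{p_3}}+C'\right)$$ is bounded, and for each of its elements $(i,j,n)$ the coefficient of $x^iy^jt^n$ in $p_3(\phi)F(p_1(\phi),p_2(\phi))$ is zero, then return True. Step 5. (After the loop.) Return Failed.
   Formalization: Step 3 also requires φ to lie in C_≼((x,y)) for the chosen order (recCone(Newt(φ)) ⊆ C_0 alone does not ensure it, e.g. φ = 1/(1−x)+1/y), and C_≼((x,y)) consists of series whose bounding cone is compatible with ≼, as needed for a field. *)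

theory Defs
  imports
    "HOL-Analysis.Analysis"
    "HOL-Computational_Algebra.Computational_Algebra"
    "HOL-Algebra.Algebraic_Closure_Type"
begin

text \<open>
  The library's \<^const>\<open>conic\<close> is closure under scaling by all nonnegative reals; it admits the
  empty set, which is excluded here so that \<open>0\<close> always belongs to a cone.
\<close>

definition is_cone :: "(real ^ 'n) set \<Rightarrow> bool" where
  "is_cone C \<longleftrightarrow> conic C \<and> C \<noteq> {}"

definition strictly_convex :: "(real ^ 'n) set \<Rightarrow> bool" where
  "strictly_convex C \<longleftrightarrow> is_cone C \<and> convex C \<and> C \<inter> uminus ` C = {0}"

definition generated_cone :: "(real ^ 'n) set \<Rightarrow> (real ^ 'n) set" where
  "generated_cone V = {\<Sum>v\<in>V. c v *\<^sub>R v |c. \<forall>v\<in>V. 0 \<le> c v}"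

definition polyhedral_cone :: "(real ^ 'n) set \<Rightarrow> bool" where
  "polyhedral_cone C \<longleftrightarrow> (\<exists>V. finite V \<and> C = generated_cone V)"

definition rational_cone :: "(real ^ 'n) set \<Rightarrow> bool" where
  "rational_cone C \<longleftrightarrow> (\<exists>V. finite V \<and> (\<forall>v\<in>V. \<forall>i. v $ i \<in> \<rat>) \<and> C = generated_cone V)"

definition dual_cone :: "(real ^ 'n) set \<Rightarrow> (real ^ 'n) set" where
  "dual_cone C = {u. \<forall>v\<in>C. u \<bullet> v \<le> 0}"

definition rec_cone :: "(real ^ 'n) set \<Rightarrow> (real ^ 'n) set" where
  "rec_cone P = {v. \<forall>p\<in>P. \<forall>r\<ge>0. p + r *\<^sub>R v \<in> P}"

definition minkowski_sum :: "(real ^ 'n) set \<Rightarrow> (real ^ 'n) set \<Rightarrow> (real ^ 'n) set" where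
  "minkowski_sum A B = {a + b |a b. a \<in> A \<and> b \<in> B}"

definition emb :: "real ^ 2 \<Rightarrow> real ^ 3" where
  "emb v = vector [v $ 1, v $ 2, 0]"

definition rvec :: "rat ^ 'n \<Rightarrow> real ^ 'n" where
  "rvec I = (\<chi> i. of_rat (I $ i))"

text \<open>
  Every \<open>w\<close> induces a total preorder; it is an order exactly if it is antisymmetric, that is, if
  the components of \<open>w\<close> are linearly independent over the rationals.
\<close>

definition induces_order :: "real ^ 'n \<Rightarrow> (rat ^ 'n \<Rightarrow> rat ^ 'n \<Rightarrow> bool) \<Rightarrow> bool" where
  "induces_order w leq \<longleftrightarrow>
     (\<forall>a b. leq a b \<longleftrightarrow> rvec a \<bullet> w \<le> rvec b \<bullet> w) \<and> (\<forall>a b. leq a b \<longrightarrow> leq b a \<longrightarrow> a = b)"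

definition additive_total_order :: "(rat ^ 'n \<Rightarrow> rat ^ 'n \<Rightarrow> bool) \<Rightarrow> bool" where
  "additive_total_order leq \<longleftrightarrow> (\<exists>w. induces_order w leq)"

text \<open>A series is represented by its coefficient function.\<close>

type_synonym 'n series = "(rat, 'n) vec \<Rightarrow> complex"

definition supp :: "'n::finite series \<Rightarrow> (real ^ 'n) set" where
  "supp g = rvec ` {I. g I \<noteq> 0}"

definition newt :: "'n::finite series \<Rightarrow> (real ^ 'n) set" where
  "newt g = convex hull supp g"

definition ser_zero :: "'n::finite series" where
  "ser_zero = (\<lambda>I. 0)"

definition is_leading_exp :: "(rat ^ 'n \<Rightarrow> rat ^ 'n \<Rightarrow> bool) \<Rightarrow> 'n::finite series \<Rightarrow> rat ^ 'n \<Rightarrow> bool" where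
  "is_leading_exp leq g I \<longleftrightarrow> g I \<noteq> 0 \<and> (\<forall>J. g J \<noteq> 0 \<longrightarrow> leq J I)"

definition leading_exp :: "(rat ^ 'n \<Rightarrow> rat ^ 'n \<Rightarrow> bool) \<Rightarrow> 'n::finite series \<Rightarrow> rat ^ 'n" where
  "leading_exp leq g = (THE I. is_leading_exp leq g I)"

text \<open>
  The field of series attached to an order \<open>\<preceq>\<close>: the zero series, and the series whose
  support has a \<open>\<preceq>\<close>-maximal element. The cone \<open>C\<close> that bounds the support is required to be
  compatible with \<open>\<preceq>\<close>, i.e. \<open>0\<close> is the maximal rational point of \<open>C\<close>. This is needed for a
  field: for \<open>w = (1, \<surd>2)\<close> the series with support \<open>{(-n, \<lfloor>n / \<surd>2\<rfloor>) | n \<ge> 0}\<close> has a maximal exponent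
  and a support in a strictly convex rational cone, but subtracting its leading term
  leaves a series without a maximal exponent.
\<close>

definition series_field :: "(rat ^ 'n \<Rightarrow> rat ^ 'n \<Rightarrow> bool) \<Rightarrow> 'n::finite series set" where
  "series_field leq = {g.
     (\<exists>v C (k::int). rational_cone C \<and> strictly_convex C \<and> (\<forall>I. rvec I \<in> C \<longrightarrow> leq I 0) \<and>
        k \<noteq> 0 \<and> supp g \<subseteq> (+) v ` C \<and> (\<forall>z\<in>supp g. \<forall>i. of_int k * z $ i \<in> \<int>)) \<and>
     (g = ser_zero \<or> (\<exists>I. is_leading_exp leq g I))}"

definition ser_monom :: "complex \<Rightarrow> rat ^ 'n \<Rightarrow> 'n::finite series" where
  "ser_monom c I = (\<lambda>J. if J = I then c else 0)"

definition ser_diff :: "'n::finite series \<Rightarrow> 'n series \<Rightarrow> 'n series" where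
  "ser_diff f g = (\<lambda>I. f I - g I)"

text \<open>
  For two elements of one field \<^term>\<open>series_field leq\<close> the index set below is finite, and so is the one
  in \<open>formal_sum\<close> for the geometric series to which it is applied.
\<close>

definition ser_mult :: "'n::finite series \<Rightarrow> 'n series \<Rightarrow> 'n series" where
  "ser_mult f g = (\<lambda>K. \<Sum>I | f I \<noteq> 0 \<and> g (K - I) \<noteq> 0. f I * g (K - I))"

primrec ser_power :: "'n::finite series \<Rightarrow> nat \<Rightarrow> 'n series" where
  "ser_power g 0 = ser_monom 1 0"
| "ser_power g (Suc n) = ser_mult g (ser_power g n)"

definition formal_sum :: "(nat \<Rightarrow> 'n::finite series) \<Rightarrow> 'n series" where
  "formal_sum f = (\<lambda>I. \<Sum>k | f k I \<noteq> 0. f k I)"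

text \<open>
  In \<^typ>\<open>complex poly poly\<close> the inner variable is \<open>x\<close> and the outer one is \<open>y\<close>: the coefficient of
  \<open>x^i y^j\<close> in \<open>p\<close> is \<open>coeff (coeff p j) i\<close>.
\<close>

type_synonym bipoly = "complex poly poly"
type_synonym ratfun = "complex poly poly fract"

definition bicoeff :: "bipoly \<Rightarrow> nat \<Rightarrow> nat \<Rightarrow> complex" where
  "bicoeff p i j = Polynomial.coeff (Polynomial.coeff p j) i"

definition ser_of_bipoly :: "bipoly \<Rightarrow> 2 series" where
  "ser_of_bipoly p = (\<lambda>I. if I $ 1 \<in> \<nat> \<and> I $ 2 \<in> \<nat>
     then bicoeff p (nat \<lfloor>I $ 1\<rfloor>) (nat \<lfloor>I $ 2\<rfloor>) else 0)"

definition ratfun_over_rat :: "ratfun set" where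
  "ratfun_over_rat = {Fract p q |p q. q \<noteq> 0 \<and>
     (\<forall>i j. bicoeff p i j \<in> \<rat>) \<and> (\<forall>i j. bicoeff q i j \<in> \<rat>)}"

text \<open>\<open>p / q = p / lt(q) * (\<Sum>k. (1 - q / lt(q)) ^ k)\<close>\<close>

definition expand_frac :: "(rat ^ 2 \<Rightarrow> rat ^ 2 \<Rightarrow> bool) \<Rightarrow> bipoly \<Rightarrow> bipoly \<Rightarrow> 2 series" where
  "expand_frac leq p q =
     (let Q = ser_of_bipoly q;
          I = leading_exp leq Q;
          lt_inv = ser_monom (1 / Q I) (- I)
      in ser_mult (ser_mult (ser_of_bipoly p) lt_inv)
           (formal_sum (\<lambda>k. ser_power (ser_diff (ser_monom 1 0) (ser_mult Q lt_inv)) k)))"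

text \<open>For a total order the series does not depend on the chosen representation \<open>p / q\<close>.\<close>

definition expand :: "(rat ^ 2 \<Rightarrow> rat ^ 2 \<Rightarrow> bool) \<Rightarrow> ratfun \<Rightarrow> 2 series" where
  "expand leq r = (SOME g. \<exists>p q. q \<noteq> 0 \<and> r = Fract p q \<and> g = expand_frac leq p q)"

definition ser_eval :: "(rat ^ 2 \<Rightarrow> rat ^ 2 \<Rightarrow> bool) \<Rightarrow> ratfun poly \<Rightarrow> 2 series \<Rightarrow> 2 series" where
  "ser_eval leq p \<phi> = (\<lambda>I. \<Sum>i\<le>Polynomial.degree p.
     ser_mult (expand leq (Polynomial.coeff p i)) (ser_power \<phi> i) I)"

definition is_minimal_poly :: "'a::field poly \<Rightarrow> 'a alg_closure \<Rightarrow> bool" where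
  "is_minimal_poly m a \<longleftrightarrow> Polynomial.lead_coeff m = 1 \<and> poly (map_poly to_ac m) a = 0 \<and>
     (\<forall>q. q \<noteq> 0 \<longrightarrow> poly (map_poly to_ac q) a = 0 \<longrightarrow> Polynomial.degree m \<le> Polynomial.degree q)"

definition series_root :: "ratfun poly \<Rightarrow> 2 series \<Rightarrow> bool" where
  "series_root m \<phi> \<longleftrightarrow> (\<exists>leq. additive_total_order leq \<and> \<phi> \<in> series_field leq \<and>
     ser_eval leq m \<phi> = ser_zero)"

text \<open>
  An element of \<open>\<complex>[x,y][[t]]\<close> is a \<^typ>\<open>bipoly fps\<close>; a power series in \<open>t\<close> whose coefficients are series
  in \<open>x, y\<close> is given by the sequence of its coefficients.
\<close>

type_synonym tseries = "nat \<Rightarrow> 2 series"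

definition supp_xyt :: "bipoly fps \<Rightarrow> (real ^ 3) set" where
  "supp_xyt F = {vector [of_nat i, of_nat j, of_nat n] |i j n. bicoeff (fps_nth F n) i j \<noteq> 0}"

definition subst_xy :: "bipoly fps \<Rightarrow> 2 series \<Rightarrow> 2 series \<Rightarrow> tseries" where
  "subst_xy F g1 g2 = (\<lambda>n I. \<Sum>(i, j) | bicoeff (fps_nth F n) i j \<noteq> 0.
     bicoeff (fps_nth F n) i j * ser_mult (ser_power g1 i) (ser_power g2 j) I)"

definition tser_scale :: "2 series \<Rightarrow> tseries \<Rightarrow> tseries" where
  "tser_scale g H = (\<lambda>n. ser_mult g (H n))"

definition coeff_xyt :: "tseries \<Rightarrow> rat ^ 3 \<Rightarrow> complex" where
  "coeff_xyt H J = (if J $ 3 \<in> \<nat> then H (nat \<lfloor>J $ 3\<rfloor>) (vector [J $ 1, J $ 2]) else 0)"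

definition nonneg_part :: "tseries \<Rightarrow> tseries" where
  "nonneg_part H = (\<lambda>n I. if 0 \<le> I $ 1 \<and> 0 \<le> I $ 2 then H n I else 0)"

definition tseries_ring :: "(rat ^ 2 \<Rightarrow> rat ^ 2 \<Rightarrow> bool) \<Rightarrow> tseries set" where
  "tseries_ring leq = {H. \<forall>n. H n \<in> series_field leq}"

definition term_series ::
  "(rat ^ 2 \<Rightarrow> rat ^ 2 \<Rightarrow> bool) \<Rightarrow> 2 series \<Rightarrow> bipoly fps \<Rightarrow>
   ratfun poly \<times> ratfun poly \<times> ratfun poly \<Rightarrow> tseries" where
  "term_series leq \<phi> F = (\<lambda>(p1, p2, p3).
     tser_scale (ser_eval leq p3 \<phi>) (subst_xy F (ser_eval leq p1 \<phi>) (ser_eval leq p2 \<phi>)))"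

type_synonym tuples = "(ratfun poly \<times> ratfun poly \<times> ratfun poly) list"
type_synonym estimate = "(real ^ 2) \<times> (real ^ 2) set"

definition components :: "tuples \<Rightarrow> ratfun poly set" where
  "components L0 = (\<Union>(p1, p2, p3)\<in>set L0. {p1, p2, p3})"

text \<open>
  Only strictly convex polyhedral cones are considered. A line spanned by a rational vector has
  no element in its dual that induces a total order, so the condition would hold vacuously for it.
\<close>

definition determines_expansions :: "tuples \<Rightarrow> (real ^ 2) set \<Rightarrow> bool" where
  "determines_expansions L0 C \<longleftrightarrow> polyhedral_cone C \<and> strictly_convex C \<and>
     (\<forall>w \<in> dual_cone C. \<forall>w' \<in> dual_cone C. \<forall>leq leq'. induces_order w leq \<longrightarrow> induces_order w' leq' \<longrightarrow>
        (\<forall>p \<in> components L0. \<forall>i.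
           expand leq (Polynomial.coeff p i) = expand leq' (Polynomial.coeff p i)))"

definition step1 :: "tuples \<Rightarrow> (real ^ 2) set list \<Rightarrow> bool" where
  "step1 L0 L1 \<longleftrightarrow> set L1 =
     {C. determines_expansions L0 C \<and> (\<forall>D. determines_expansions L0 D \<longrightarrow> D \<subseteq> C \<longrightarrow> D = C)}"

text \<open>
  The values \<open>p(\<phi>)\<close> are taken in \<^term>\<open>series_field leq\<close>, so \<open>\<phi>\<close> has to be an element of that
  field. For \<open>\<phi> = 1 / (1 - x) + 1 / y\<close> expanded in powers of \<open>x\<close>, the convex hull of the support is
  not closed and its recession cone is \<open>{0}\<close>; so a cone \<open>C0\<close> containing the recession cone does not by
  itself ensure this.
\<close>

definition step3 ::
  "2 series \<Rightarrow> (real ^ 2) set \<Rightarrow> tuples \<Rightarrow> (real ^ 2) set \<Rightarrow>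
   (rat ^ 2 \<Rightarrow> rat ^ 2 \<Rightarrow> bool) \<Rightarrow> (ratfun poly \<Rightarrow> estimate list) \<Rightarrow> bool" where
  "step3 \<phi> C0 L0 C leq Lp \<longleftrightarrow>
     (\<exists>w \<in> dual_cone (minkowski_sum C C0). induces_order w leq) \<and>
     \<phi> \<in> series_field leq \<and>
     (\<forall>p \<in> components L0. \<forall>(v, D) \<in> set (Lp p).
        v extreme_point_of newt (ser_eval leq p \<phi>) \<and>
        strictly_convex D \<and> supp (ser_eval leq p \<phi>) \<subseteq> (+) v ` D)"

definition composition_cone ::
  "(real ^ 3) set \<Rightarrow> estimate \<Rightarrow> estimate \<Rightarrow> (real ^ 3) set \<Rightarrow> bool" where
  "composition_cone C1 = (\<lambda>(v1, D1) (v2, D2) C'.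
     (let M = transpose (vector [emb v1, emb v2, vector [0, 0, 1]]) :: real ^ 3 ^ 3
      in C1 \<inter> {z. M *v z = 0} = {0} \<and> strictly_convex C' \<and>
         (\<lambda>z. M *v z) ` C1 \<subseteq> C' \<and> emb ` D1 \<subseteq> C' \<and> emb ` D2 \<subseteq> C'))"

text \<open>
  \<open>K\<close> is the subroutine that computes the cone \<open>C'\<close> from the two estimates.
\<close>

definition step4 ::
  "2 series \<Rightarrow> (real ^ 3) set \<Rightarrow> bipoly fps \<Rightarrow> tuples \<Rightarrow> (rat ^ 2 \<Rightarrow> rat ^ 2 \<Rightarrow> bool) \<Rightarrow>
   (ratfun poly \<Rightarrow> estimate list) \<Rightarrow> (estimate \<Rightarrow> estimate \<Rightarrow> (real ^ 3) set) \<Rightarrow> bool" where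
  "step4 \<phi> C1 F L0 leq Lp K \<longleftrightarrow> (\<forall>(p1, p2, p3) \<in> set L0.
     \<exists>e1 \<in> set (Lp p1). \<exists>e2 \<in> set (Lp p2). \<exists>(v3, D3) \<in> set (Lp p3).
       composition_cone C1 e1 e2 (K e1 e2) \<and>
       (let S = {J :: rat ^ 3. 0 \<le> J $ 1 \<and> 0 \<le> J $ 2 \<and>
                   rvec J \<in> (+) (emb v3) ` minkowski_sum (emb ` D3) (K e1 e2)}
        in bounded (rvec ` S) \<and>
           (\<forall>J \<in> S. coeff_xyt (term_series leq \<phi> F (p1, p2, p3)) J = 0)))"

datatype answer = Returned_True | Failed

text \<open>
  The loop over \<open>L1\<close>. The choices in steps 3 and 4 are nondeterministic, so the algorithm is a
  relation between inputs and the answers that are possible for some admissible choices.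
\<close>

inductive loop ::
  "2 series \<Rightarrow> (real ^ 2) set \<Rightarrow> (real ^ 3) set \<Rightarrow> bipoly fps \<Rightarrow> tuples \<Rightarrow>
   (real ^ 2) set list \<Rightarrow> answer \<Rightarrow> bool"
  for \<phi> C0 C1 F L0 where
  finished: "loop \<phi> C0 C1 F L0 [] Failed"
| skip: "\<not> strictly_convex (minkowski_sum C C0) \<Longrightarrow> loop \<phi> C0 C1 F L0 Cs a \<Longrightarrow>
    loop \<phi> C0 C1 F L0 (C # Cs) a"
| succeed: "strictly_convex (minkowski_sum C C0) \<Longrightarrow> step3 \<phi> C0 L0 C leq Lp \<Longrightarrow>
    step4 \<phi> C1 F L0 leq Lp K \<Longrightarrow> loop \<phi> C0 C1 F L0 (C # Cs) Returned_True"
| continue: "strictly_convex (minkowski_sum C C0) \<Longrightarrow> step3 \<phi> C0 L0 C leq Lp \<Longrightarrow>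
    \<not> step4 \<phi> C1 F L0 leq Lp K \<Longrightarrow> loop \<phi> C0 C1 F L0 Cs a \<Longrightarrow>
    loop \<phi> C0 C1 F L0 (C # Cs) a"

definition algorithm_A ::
  "2 series \<Rightarrow> (real ^ 2) set \<Rightarrow> (real ^ 3) set \<Rightarrow> bipoly fps \<Rightarrow> tuples \<Rightarrow> answer \<Rightarrow> bool" where
  "algorithm_A \<phi> C0 C1 F L0 a \<longleftrightarrow> (\<exists>L1. step1 L0 L1 \<and> loop \<phi> C0 C1 F L0 L1 a)"

end

theory Submission
  imports Defs
begin

text \<open>
  The support of \<open>F(p\<^sub>1(\<phi>), p\<^sub>2(\<phi>))\<close> consists of points \<open>M (i, j, n) + d\<^sub>1 + d\<^sub>2\<close> with
  \<open>(i, j, n)\<close> in \<open>C\<^sub>1\<close> and \<open>d\<^sub>1, d\<^sub>2\<close> finite sums of elements of the estimated vertex cones, so it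
  lies in the convex cone \<open>C'\<close>. Hence every term of \<open>p\<^sub>3(\<phi>) F(p\<^sub>1(\<phi>), p\<^sub>2(\<phi>))\<close> with nonnegative
  exponents in \<open>x\<close> and \<open>y\<close> is one of those whose coefficient was found to be zero in step 4, for the
  order chosen in step 3.

  That the coefficients with respect to \<open>t\<close> are elements of the field of series follows from a
  description of this field by supports only: if \<open>w\<close> induces the order, then \<open>w\<close> is strictly negative
  on the nonzero elements of a compatible rational cone \<open>C\<close>, so only finitely many lattice points of
  \<open>v + C\<close> lie above a given one, and maximal exponents exist automatically.
\<close>

section \<open>Finitely generated cones\<close>

lemma generated_cone_zero: "0 \<in> generated_cone V"
  unfolding generated_cone_def by (auto intro!: exI[of _ "\<lambda>_. 0"])

lemma generated_cone_add:
  assumes "x \<in> generated_cone V" "y \<in> generated_cone V"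
  shows "x + y \<in> generated_cone V"
proof -
  obtain c d where "x = (\<Sum>v\<in>V. c v *\<^sub>R v)" "\<forall>v\<in>V. 0 \<le> c v"
    "y = (\<Sum>v\<in>V. d v *\<^sub>R v)" "\<forall>v\<in>V. 0 \<le> d v"
    using assms unfolding generated_cone_def by blast
  then show ?thesis
    unfolding generated_cone_def
    by (auto intro!: exI[of _ "\<lambda>v. c v + d v"] simp: scaleR_left_distrib sum.distrib)
qed

lemma generated_cone_scaleR:
  assumes "x \<in> generated_cone V" "0 \<le> r"
  shows "r *\<^sub>R x \<in> generated_cone V"
proof -
  obtain c where "x = (\<Sum>v\<in>V. c v *\<^sub>R v)" "\<forall>v\<in>V. 0 \<le> c v"
    using assms unfolding generated_cone_def by blast
  then show ?thesis
    using assms(2) unfolding generated_cone_def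
    by (auto intro!: exI[of _ "\<lambda>v. r * c v"] simp: scaleR_sum_right)
qed

text \<open>A zero vector may be dropped from a generating set without shrinking the cone. This
  matters for a rational cone compatible with an order: its nonzero generators have negative product
  with \<open>w\<close>, whereas a zero generator does not.\<close>

lemma generated_cone_subset:
  assumes "finite W" "V - {0} \<subseteq> W" "finite V"
  shows "generated_cone V \<subseteq> generated_cone W"
proof
  fix x assume "x \<in> generated_cone V"
  then obtain c where c: "x = (\<Sum>v\<in>V. c v *\<^sub>R v)" "\<forall>v\<in>V. 0 \<le> c v"
    unfolding generated_cone_def by blast
  let ?d = "\<lambda>v. if v \<in> V then c v else 0"
  have "(\<Sum>v\<in>V. c v *\<^sub>R v) = (\<Sum>v\<in>V - {0}. c v *\<^sub>R v)"
    by (rule sum.mono_neutral_right) (use assms in auto)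
  also have "\<dots> = (\<Sum>v\<in>W. ?d v *\<^sub>R v)"
    by (rule sum.mono_neutral_cong_left) (use assms in auto)
  finally show "x \<in> generated_cone W"
    using c unfolding generated_cone_def by (auto intro!: exI[of _ ?d])
qed

lemma generated_cone_superset:
  assumes "finite V" "x \<in> V"
  shows "x \<in> generated_cone V"
proof -
  have "x = (\<Sum>v\<in>V. (if v = x then 1 else 0) *\<^sub>R v)"
    using assms by (simp add: if_distrib[of "\<lambda>c. c *\<^sub>R _"] sum.delta cong: if_cong)
  then show ?thesis
    unfolding generated_cone_def by (auto intro!: exI[of _ "\<lambda>v. if v = x then 1 else 0"])
qed

lemma generated_cone_inner_le_0:
  assumes "\<forall>v\<in>V. v \<bullet> w \<le> 0" "x \<in> generated_cone V"
  shows "x \<bullet> w \<le> 0"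
  using assms unfolding generated_cone_def
  by (auto simp: inner_sum_left intro!: sum_nonpos mult_nonneg_nonpos)

text \<open>The estimate holds on each generator and passes to nonnegative combinations by the
  triangle inequality. It makes every slice of the cone above a given \<open>w\<close>-level
  bounded.\<close>

lemma generated_cone_norm_le:
  fixes V :: "(real ^ 'n) set"
  assumes "finite V" "\<forall>v\<in>V. v \<bullet> w < 0"
  obtains B where "0 \<le> B" "\<And>x. x \<in> generated_cone V \<Longrightarrow> norm x \<le> B * - (x \<bullet> w)"
proof
  \<comment> \<open>A sum of nonnegative ratios dominates each of them and, unlike a maximum, also
    makes sense for empty \<open>V\<close>.\<close>
  define B where "B = (\<Sum>v\<in>V. norm v / - (v \<bullet> w))"
  show "0 \<le> B"
    unfolding B_def using assms(2) by (intro sum_nonneg divide_nonneg_pos) auto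
  fix x assume "x \<in> generated_cone V"
  then obtain c where c: "x = (\<Sum>v\<in>V. c v *\<^sub>R v)" "\<forall>v\<in>V. 0 \<le> c v"
    unfolding generated_cone_def by blast
  have le: "norm v \<le> B * - (v \<bullet> w)" if "v \<in> V" for v
  proof -
    have "norm v / - (v \<bullet> w) \<le> B"
      unfolding B_def using assms that
      by (intro member_le_sum divide_nonneg_pos) auto
    then show ?thesis
      using assms(2) that by (simp add: pos_divide_le_eq del: divide_minus_right)
  qed
  have "norm x \<le> (\<Sum>v\<in>V. norm (c v *\<^sub>R v))"
    unfolding c(1) by (rule norm_sum)
  also have "\<dots> \<le> (\<Sum>v\<in>V. c v * (B * - (v \<bullet> w)))"
  proof (rule sum_mono)
    fix v assume "v \<in> V"
    then show "norm (c v *\<^sub>R v) \<le> c v * (B * - (v \<bullet> w))"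
      using c(2) mult_left_mono[OF le, of v "c v"] by simp
  qed
  also have "\<dots> = B * - (x \<bullet> w)"
    unfolding c(1) inner_sum_left by (simp add: sum_distrib_left sum_negf mult_ac)
  finally show "norm x \<le> B * - (x \<bullet> w)" .
qed

text \<open>If \<open>x\<close> and \<open>- x\<close> both lie in the cone, then
  \<open>x \<bullet> w\<close> is both nonpositive and nonnegative, hence 0, and the norm estimate
  forces \<open>x = 0\<close>.\<close>

lemma strictly_convex_generated_cone:
  assumes "finite V" "\<forall>v\<in>V. v \<bullet> w < 0"
  shows "strictly_convex (generated_cone V)"
  unfolding strictly_convex_def is_cone_def
proof (intro conjI)
  show "conic (generated_cone V)"
    unfolding conic_def by (auto intro: generated_cone_scaleR)
  show "generated_cone V \<noteq> {}"
    using generated_cone_zero by blast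
  show "convex (generated_cone V)"
    unfolding convex_def by (auto intro!: generated_cone_add generated_cone_scaleR)
  show "generated_cone V \<inter> uminus ` generated_cone V = {0}"
  proof
    show "generated_cone V \<inter> uminus ` generated_cone V \<subseteq> {0}"
    proof
      fix x assume x: "x \<in> generated_cone V \<inter> uminus ` generated_cone V"
      then have "- x \<in> generated_cone V" by auto
      then have "x \<bullet> w = 0"
        using generated_cone_inner_le_0[of V w x] generated_cone_inner_le_0[of V w "- x"] x assms(2)
        by force
      then show "x \<in> {0}"
        using generated_cone_norm_le[OF assms] x
        by (metis IntD1 minus_zero mult_zero_right norm_le_zero_iff singleton_iff)
    qed
    show "{0} \<subseteq> generated_cone V \<inter> uminus ` generated_cone V"
      using generated_cone_zero by force
  qed
qed

text \<open>The sum is twice the midpoint.\<close>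

lemma convex_cone_add:
  assumes "strictly_convex C" "x \<in> C" "y \<in> C"
  shows "x + y \<in> C"
proof -
  have "(1/2) *\<^sub>R x + (1/2) *\<^sub>R y \<in> C"
    using assms unfolding strictly_convex_def by (intro convexD) auto
  then have "2 *\<^sub>R ((1/2) *\<^sub>R x + (1/2) *\<^sub>R y) \<in> C"
    using assms(1) unfolding strictly_convex_def is_cone_def conic_def by force
  then show ?thesis by (simp add: scaleR_right_distrib)
qed

lemma strictly_convex_zero: "strictly_convex C \<Longrightarrow> 0 \<in> C"
  unfolding strictly_convex_def by blast

section \<open>Exponents\<close>

lemma rvec_diff: "rvec (I - J) = rvec I - rvec J"
  by (simp add: rvec_def vec_eq_iff of_rat_diff)

lemma rvec_zero: "rvec 0 = 0"
  by (simp add: rvec_def vec_eq_iff)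

lemma rvec_eq_iff: "rvec I = rvec J \<longleftrightarrow> I = J"
  by (simp add: rvec_def vec_eq_iff)

text \<open>Compatibility of a cone with an order speaks about rational exponents only; this makes
  it applicable to the rational generators of the cone.\<close>

lemma range_rvec:
  fixes x :: "real ^ 'n"
  assumes "\<forall>i. x $ i \<in> \<rat>"
  obtains I where "x = rvec I"
proof -
  from assms have "\<forall>i. \<exists>q. x $ i = of_rat q"
    by (meson Rats_cases)
  then obtain f where "\<forall>i. x $ i = of_rat (f i)"
    by metis
  then have "x = rvec (\<chi> i. f i)"
    by (simp add: rvec_def vec_eq_iff)
  then show ?thesis ..
qed

text \<open>Scaling by \<open>k\<close> turns the points into integer vectors whose entries are
  bounded by \<open>\<bar>k\<bar> * R\<close>.\<close>

lemma finite_lattice_ball: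
  fixes k :: int
  assumes "k \<noteq> 0"
  shows "finite {z :: real ^ 'n. norm z \<le> R \<and> (\<forall>i. of_int k * z $ i \<in> \<int>)}" (is "finite ?S")
proof (rule finite_subset)
  define N where "N = \<lceil>\<bar>of_int k\<bar> * R\<rceil>"
  let ?T = "(\<lambda>f. (\<chi> i. of_int (f i) / of_int k) :: real ^ 'n) ` Pi\<^sub>E (UNIV :: 'n set) (\<lambda>_. {- N..N})"
  show "?S \<subseteq> ?T"
  proof
    fix z assume "z \<in> ?S"
    then have z: "norm z \<le> R" "\<forall>i. of_int k * z $ i \<in> \<int>" by auto
    define f where "f i = \<lfloor>of_int k * z $ i\<rfloor>" for i
    have f: "of_int k * z $ i = of_int (f i)" for i
      using z(2) by (simp add: f_def)
    have "f i \<in> {- N..N}" for i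
    proof -
      have "\<bar>real_of_int (f i)\<bar> = \<bar>of_int k\<bar> * \<bar>z $ i\<bar>"
        by (simp add: f[symmetric] abs_mult)
      also have "\<dots> \<le> \<bar>of_int k\<bar> * R"
        using component_le_norm_cart[of z i] z(1) by (intro mult_left_mono) auto
      also have "\<dots> \<le> of_int N"
        unfolding N_def by simp
      finally show ?thesis by (simp, linarith)
    qed
    moreover have "z = (\<chi> i. of_int (f i) / of_int k)"
      using assms by (simp add: vec_eq_iff f[symmetric])
    ultimately show "z \<in> ?T" by blast
  qed
  show "finite ?T"
    by (intro finite_imageI finite_PiE) auto
qed

text \<open>If the product were 0, then \<open>leq 0 I\<close> would hold as well, and antisymmetry
  would give \<open>I = 0\<close>.\<close>

lemma induces_order_neg:
  assumes "induces_order w leq" "leq I 0" "I \<noteq> 0"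
  shows "rvec I \<bullet> w < 0"
  using assms unfolding induces_order_def rvec_zero by (metis inner_zero_left linorder_not_less rvec_zero)

section \<open>Admissible supports\<close>

text \<open>Membership in \<open>series_field leq\<close> expressed through \<open>w\<close> and the
  support alone, without a maximal exponent. Negativity is demanded of the generators, so it is
  inherited by unions of generating sets. An empty \<open>V\<close> is allowed and stands for the
  cone {0}.\<close>

definition admissible :: "real ^ 'n \<Rightarrow> (real ^ 'n) set \<Rightarrow> bool" where
  "admissible w S \<longleftrightarrow> (\<exists>v V (k::int). finite V \<and> (\<forall>x\<in>V. x \<bullet> w < 0 \<and> (\<forall>i. x $ i \<in> \<rat>)) \<and>
     k \<noteq> 0 \<and> S \<subseteq> (+) v ` generated_cone V \<and> (\<forall>z\<in>S. \<forall>i. of_int k * z $ i \<in> \<int>))"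

lemma admissibleE:
  fixes w :: "real ^ 'n" and S :: "(real ^ 'n) set"
  assumes "admissible w S"
  obtains v V and k :: int where "finite V" "\<forall>x\<in>V. x \<bullet> w < 0 \<and> (\<forall>i. x $ i \<in> \<rat>)" "k \<noteq> 0"
    "S \<subseteq> (+) v ` generated_cone V" "\<forall>z\<in>S. \<forall>i. of_int k * z $ i \<in> \<int>"
  using assms unfolding admissible_def by (elim exE conjE)

lemma admissible_subset: "admissible w S \<Longrightarrow> T \<subseteq> S \<Longrightarrow> admissible w T"
  unfolding admissible_def by (meson subset_trans subsetD)

lemma admissible_empty: "admissible w {}"
  unfolding admissible_def by (auto intro!: exI[of _ "{}"] exI[of _ "1::int"])

text \<open>The apex is the point itself and the cone is {0}; the product of the denominators of all
  components serves as a common denominator.\<close>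

lemma admissible_rvec: "admissible w {rvec I}"
proof -
  have "\<exists>n::int. n \<noteq> 0 \<and> of_int n * rvec I $ i \<in> \<int>" for i
  proof -
    have "rvec I $ i = of_int (fst (quotient_of (I $ i))) / of_int (snd (quotient_of (I $ i)))"
      unfolding rvec_def
      by (simp, metis of_rat_divide of_rat_of_int_eq prod.collapse quotient_of_div)
    moreover have "snd (quotient_of (I $ i)) \<noteq> 0"
      using quotient_of_denom_pos'[of "I $ i"] by simp
    ultimately show ?thesis
      by (intro exI[of _ "snd (quotient_of (I $ i))"]) simp
  qed
  then obtain n :: "'a \<Rightarrow> int" where n: "\<And>i. n i \<noteq> 0" "\<And>i. of_int (n i) * rvec I $ i \<in> \<int>"
    by metis
  have "of_int (\<Prod>j\<in>UNIV. n j) * rvec I $ i \<in> \<int>" for i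
  proof -
    have "of_int (\<Prod>j\<in>UNIV. n j) * rvec I $ i =
        of_int (\<Prod>j\<in>UNIV - {i}. n j) * (of_int (n i) * rvec I $ i)"
      by (simp add: prod.remove[of UNIV i] mult_ac)
    also have "\<dots> \<in> \<int>"
      by (rule Ints_mult[OF Ints_of_int n(2)])
    finally show ?thesis .
  qed
  then show ?thesis
    unfolding admissible_def using n(1) generated_cone_zero[of "{}"]
    by (intro exI[of _ "rvec I"] exI[of _ "{}"] exI[of _ "\<Prod>j\<in>UNIV. n j"]) (auto simp: image_iff)
qed

text \<open>Apices add, generating sets unite and denominators multiply.\<close>

lemma admissible_plus:
  fixes w :: "real ^ 'n"
  assumes "admissible w S" "admissible w T"
  shows "admissible w {x + y |x y. x \<in> S \<and> y \<in> T}"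
proof -
  obtain a A k where A: "finite A" "\<forall>x\<in>A. x \<bullet> w < 0 \<and> (\<forall>i. x $ i \<in> \<rat>)" "k \<noteq> 0"
      "S \<subseteq> (+) a ` generated_cone A" "\<forall>z\<in>S. \<forall>i. of_int k * z $ i \<in> \<int>"
    using assms(1) by (rule admissibleE)
  obtain b B l where B: "finite B" "\<forall>x\<in>B. x \<bullet> w < 0 \<and> (\<forall>i. x $ i \<in> \<rat>)" "l \<noteq> 0"
      "T \<subseteq> (+) b ` generated_cone B" "\<forall>z\<in>T. \<forall>i. of_int l * z $ i \<in> \<int>"
    using assms(2) by (rule admissibleE)
  have sub: "generated_cone A \<subseteq> generated_cone (A \<union> B)"
    "generated_cone B \<subseteq> generated_cone (A \<union> B)"
    by (rule generated_cone_subset; use A(1) B(1) in auto)+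
  have "x + y \<in> (+) (a + b) ` generated_cone (A \<union> B)" if "x \<in> S" "y \<in> T" for x y
  proof -
    obtain c d where "x = a + c" "c \<in> generated_cone A" "y = b + d" "d \<in> generated_cone B"
      using \<open>x \<in> S\<close> \<open>y \<in> T\<close> A(4) B(4) by blast
    then show ?thesis
      using sub by (intro image_eqI[of _ _ "c + d"]) (auto intro: generated_cone_add)
  qed
  moreover have "of_int (k * l) * (x + y) $ i \<in> \<int>" if "x \<in> S" "y \<in> T" for x y :: "real ^ 'n" and i
  proof -
    have "of_int (k * l) * (x + y) $ i = of_int l * (of_int k * x $ i) + of_int k * (of_int l * y $ i)"
      by (simp add: algebra_simps)
    also have "\<dots> \<in> \<int>"
      by (rule Ints_add; rule Ints_mult[OF Ints_of_int]) (use that A(5) B(5) in auto)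
    finally show ?thesis .
  qed
  ultimately show ?thesis
    unfolding admissible_def using A B
    by (intro exI[of _ "a + b"] exI[of _ "A \<union> B"] exI[of _ "k * l"]) auto
qed

text \<open>
  A common apex for the two supports exists once the cone contains the orthant generated by the
  vectors \<open>- sgn (w $ i) *\<^sub>R axis i 1\<close>; the components of \<open>w\<close> are nonzero because \<open>w\<close> induces an order.
\<close>

lemma admissible_Un:
  fixes w :: "real ^ 'n"
  assumes w: "induces_order w leq" and "admissible w S" "admissible w T"
  shows "admissible w (S \<union> T)"
proof -
  obtain a A k where A: "finite A" "\<forall>x\<in>A. x \<bullet> w < 0 \<and> (\<forall>i. x $ i \<in> \<rat>)" "k \<noteq> 0"
      "S \<subseteq> (+) a ` generated_cone A" "\<forall>z\<in>S. \<forall>i. of_int k * z $ i \<in> \<int>"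
    using assms(2) by (rule admissibleE)
  obtain b B l where B: "finite B" "\<forall>x\<in>B. x \<bullet> w < 0 \<and> (\<forall>i. x $ i \<in> \<rat>)" "l \<noteq> 0"
      "T \<subseteq> (+) b ` generated_cone B" "\<forall>z\<in>T. \<forall>i. of_int l * z $ i \<in> \<int>"
    using assms(3) by (rule admissibleE)
  define u :: "'n \<Rightarrow> real ^ 'n" where "u i = (- sgn (w $ i)) *\<^sub>R axis i 1" for i
  define E where "E = A \<union> B \<union> range u"
  have w0: "w $ i \<noteq> 0" for i
  proof
    assume "w $ i = 0"
    moreover have "rvec (axis i 1) = axis i 1"
      by (simp add: rvec_def vec_eq_iff axis_def)
    ultimately have "rvec (axis i 1) \<bullet> w = rvec 0 \<bullet> w"
      by (simp add: inner_axis' rvec_zero)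
    then have "axis i (1::rat) = 0"
      using w unfolding induces_order_def by (metis order_refl)
    then show False by simp
  qed
  have u: "u i \<bullet> w < 0" "u i $ j \<in> \<rat>" for i j
    using w0[of i] by (auto simp: u_def inner_axis' sgn_if) (auto simp: axis_def)
  have fin: "finite E"
    using A(1) B(1) by (simp add: E_def)
  have sub: "generated_cone A \<subseteq> generated_cone E" "generated_cone B \<subseteq> generated_cone E"
    by (rule generated_cone_subset[OF fin]; use A(1) B(1) in \<open>auto simp: E_def\<close>)+
  \<comment> \<open>In each coordinate the apex takes whichever of \<open>a\<close> and
    \<open>b\<close> lies further in the direction of \<open>w\<close>, so no component of
    \<open>a - v\<close> or \<open>b - v\<close> has the same sign as that of
    \<open>w\<close>.\<close>
  define v :: "real ^ 'n" where "v = (\<chi> i. if w $ i < 0 then min (a $ i) (b $ i) else max (a $ i) (b $ i))"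
  have orthant: "c \<in> generated_cone E" if "\<And>i. c $ i * sgn (w $ i) \<le> 0" for c
  proof -
    have sum_mem: "(\<Sum>i\<in>U. (- (c $ i * sgn (w $ i))) *\<^sub>R u i) \<in> generated_cone E" if "finite U" for U
      using that
    proof induction
      case empty
      then show ?case by (simp add: generated_cone_zero)
    next
      case (insert i U)
      have "u i \<in> generated_cone E"
        by (rule generated_cone_superset[OF fin]) (auto simp: E_def)
      then have "(- (c $ i * sgn (w $ i))) *\<^sub>R u i \<in> generated_cone E"
        using \<open>c $ i * sgn (w $ i) \<le> 0\<close> by (intro generated_cone_scaleR) auto
      then show ?case
        using insert by (simp add: generated_cone_add del: scaleR_minus_left)
    qed
    have "(- (c $ i * sgn (w $ i))) *\<^sub>R u i = c $ i *\<^sub>R axis i 1" for i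
      using w0[of i] by (simp add: u_def sgn_if)
    \<comment> \<open>The two sign factors cancel, so this is the expansion of \<open>c\<close> in
      the standard basis, rewritten with nonnegative coefficients on the vectors
      \<open>u i\<close>.\<close>
    then have "c = (\<Sum>i\<in>UNIV. (- (c $ i * sgn (w $ i))) *\<^sub>R u i)"
      using basis_expansion[of c] by (simp add: scalar_mult_eq_scaleR del: scaleR_minus_left)
    then show ?thesis
      using sum_mem[of UNIV] by simp
  qed
  have apex: "a - v \<in> generated_cone E" "b - v \<in> generated_cone E"
    using w0 by (auto intro!: orthant simp: v_def sgn_if)
  have "S \<union> T \<subseteq> (+) v ` generated_cone E"
  proof
    fix z assume "z \<in> S \<union> T"
    then obtain c d where "z = c + d" "c - v \<in> generated_cone E" "d \<in> generated_cone E"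
      using A(4) B(4) sub apex by blast
    then show "z \<in> (+) v ` generated_cone E"
      by (intro image_eqI[of _ _ "(c - v) + d"]) (auto intro: generated_cone_add)
  qed
  moreover have "of_int (k * l) * z $ i \<in> \<int>" if "z \<in> S \<union> T" for z :: "real ^ 'n" and i
  proof -
    have eq: "of_int (k * l) * z $ i = of_int l * (of_int k * z $ i)"
      "of_int (k * l) * z $ i = of_int k * (of_int l * z $ i)"
      by simp_all
    from that show ?thesis
    proof
      assume "z \<in> S"
      then show ?thesis unfolding eq(1) using A(5) Ints_mult[OF Ints_of_int] by blast
    next
      assume "z \<in> T"
      then show ?thesis unfolding eq(2) using B(5) Ints_mult[OF Ints_of_int] by blast
    qed
  qed
  ultimately show ?thesis
    unfolding admissible_def using A B u fin
    by (intro exI[of _ v] exI[of _ E] exI[of _ "k * l"]) (auto simp: E_def)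
qed

lemma admissible_finite:
  assumes "induces_order w leq" "finite A"
  shows "admissible w (rvec ` A)"
  using assms(2)
proof induction
  case empty
  then show ?case by (simp add: admissible_empty)
next
  case (insert I A)
  then show ?case
    using admissible_Un[OF assms(1) admissible_rvec, of "rvec ` A" I] by simp
qed

section \<open>Leading exponents and the description of the field of series by supports\<close>

lemma admissible_max:
  assumes "induces_order w leq" "admissible w (supp g)" "g \<noteq> ser_zero"
  shows "\<exists>I. is_leading_exp leq g I"
proof -
  obtain v V and k :: int where V: "finite V" "\<forall>x\<in>V. x \<bullet> w < 0" "k \<noteq> 0"
    "supp g \<subseteq> (+) v ` generated_cone V" "\<forall>z\<in>supp g. \<forall>i. of_int k * z $ i \<in> \<int>"
    using assms(2) unfolding admissible_def by blast
  obtain B where B: "0 \<le> B" "\<And>x. x \<in> generated_cone V \<Longrightarrow> norm x \<le> B * - (x \<bullet> w)"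
    using generated_cone_norm_le[OF V(1,2)] by blast
  obtain I\<^sub>0 where I\<^sub>0: "g I\<^sub>0 \<noteq> 0"
    using assms(3) unfolding ser_zero_def by blast
  \<comment> \<open>For \<open>z = v + x\<close> at least as high as \<open>rvec I\<^sub>0\<close>,
    the quantity \<open>- (x \<bullet> w)\<close> is at most
    \<open>v \<bullet> w - rvec I\<^sub>0 \<bullet> w\<close>, which bounds the norm of
    \<open>x\<close>. Only the exponents in \<open>U\<close> can compete for the maximum.\<close>
  define R where "R = norm v + B * (v \<bullet> w - rvec I\<^sub>0 \<bullet> w)"
  define U where "U = {J. g J \<noteq> 0 \<and> rvec I\<^sub>0 \<bullet> w \<le> rvec J \<bullet> w}"
  have "rvec ` U \<subseteq> {z. norm z \<le> R \<and> (\<forall>i. of_int k * z $ i \<in> \<int>)}"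
  proof
    fix z assume "z \<in> rvec ` U"
    then have z: "z \<in> supp g" "rvec I\<^sub>0 \<bullet> w \<le> z \<bullet> w"
      by (auto simp: U_def supp_def)
    then obtain x where x: "x \<in> generated_cone V" "z = v + x"
      using V(4) by blast
    have "norm z \<le> norm v + norm x"
      unfolding x by (rule norm_triangle_ineq)
    also have "norm x \<le> B * - (x \<bullet> w)"
      using B(2) x by blast
    also have "\<dots> \<le> B * (v \<bullet> w - rvec I\<^sub>0 \<bullet> w)"
      using z(2) B(1) unfolding x by (intro mult_left_mono) (auto simp: inner_add_left)
    finally show "z \<in> {z. norm z \<le> R \<and> (\<forall>i. of_int k * z $ i \<in> \<int>)}"
      using V(5) z(1) by (auto simp: R_def)
  qed
  then have "finite (rvec ` U)"
    using finite_lattice_ball[OF V(3)] finite_subset by blast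
  then have fin: "finite U"
    by (rule finite_imageD) (auto simp: inj_on_def rvec_eq_iff)
  have "U \<noteq> {}"
    using I\<^sub>0 by (auto simp: U_def)
  with fin have "Max ((\<lambda>J. rvec J \<bullet> w) ` U) \<in> (\<lambda>J. rvec J \<bullet> w) ` U"
    by (intro Max_in) auto
  then obtain I where I: "I \<in> U" "Max ((\<lambda>J. rvec J \<bullet> w) ` U) = rvec I \<bullet> w"
    by blast
  have max: "rvec J \<bullet> w \<le> rvec I \<bullet> w" if "g J \<noteq> 0" for J
  proof (cases "J \<in> U")
    case True
    then show ?thesis using fin I(2) by (metis Max_ge finite_imageI imageI)
  next
    case False
    then show ?thesis using that I(1) by (auto simp: U_def)
  qed
  show ?thesis
    using I(1) max assms(1) unfolding is_leading_exp_def induces_order_def U_def by blast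
qed

lemma series_field_iff_admissible:
  fixes w :: "real ^ 'n"
  assumes w: "induces_order w leq"
  shows "g \<in> series_field leq \<longleftrightarrow> admissible w (supp g)"
proof
  assume "g \<in> series_field leq"
  then obtain v C and k :: int where C: "rational_cone C" "\<forall>I. rvec I \<in> C \<longrightarrow> leq I 0" "k \<noteq> 0"
    "supp g \<subseteq> (+) v ` C" "\<forall>z\<in>supp g. \<forall>i. of_int k * z $ i \<in> \<int>"
    unfolding series_field_def by blast
  obtain V where V: "finite V" "\<forall>v\<in>V. \<forall>i. (v :: real ^ 'n) $ i \<in> \<rat>" "C = generated_cone V"
    using C(1) unfolding rational_cone_def by blast
  \<comment> \<open>A nonzero generator is itself a rational point of \<open>C\<close>, so
    compatibility with the order applies to it directly.\<close>
  have "x \<bullet> w < 0" if x: "x \<in> V - {0}" for x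
  proof -
    obtain I where I: "x = rvec I"
      using V(2) x by (metis DiffD1 range_rvec)
    have "rvec I \<in> C"
      using x V I generated_cone_superset by blast
    moreover have "I \<noteq> 0"
      using x I rvec_zero by auto
    ultimately show ?thesis
      using induces_order_neg[OF w] C(2) I by blast
  qed
  moreover have "C \<subseteq> generated_cone (V - {0})"
    unfolding V(3) using V(1) by (intro generated_cone_subset) auto
  ultimately show "admissible w (supp g)"
    unfolding admissible_def using C V
    by (intro exI[of _ v] exI[of _ "V - {0}"] exI[of _ k]) blast
next
  assume adm: "admissible w (supp g)"
  then obtain v V and k :: int where V: "finite V" "\<forall>x\<in>V. x \<bullet> w < 0 \<and> (\<forall>i. x $ i \<in> \<rat>)" "k \<noteq> 0"
    "supp g \<subseteq> (+) v ` generated_cone V" "\<forall>z\<in>supp g. \<forall>i. of_int k * z $ i \<in> \<int>"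
    unfolding admissible_def by blast
  have "rational_cone (generated_cone V)"
    unfolding rational_cone_def using V by blast
  moreover have "strictly_convex (generated_cone V)"
    using V by (intro strictly_convex_generated_cone[of _ w]) auto
  moreover have "leq I 0" if "rvec I \<in> generated_cone V" for I
  proof -
    have "rvec I \<bullet> w \<le> 0"
      by (rule generated_cone_inner_le_0[OF _ that]) (use V in force)
    then show ?thesis
      using w unfolding induces_order_def by (simp add: rvec_zero)
  qed
  ultimately show "g \<in> series_field leq"
    unfolding series_field_def using V admissible_max[OF w adm] by blast
qed

section \<open>Supports of products, sums and expansions\<close>

lemma supp_ser_mult: "supp (ser_mult f g) \<subseteq> {x + y |x y. x \<in> supp f \<and> y \<in> supp g}"
proof
  fix z assume "z \<in> supp (ser_mult f g)"
  then obtain K where K: "z = rvec K" "ser_mult f g K \<noteq> 0"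
    unfolding supp_def by blast
  from K(2) obtain I where "f I \<noteq> 0" "g (K - I) \<noteq> 0"
    unfolding ser_mult_def by (elim sum.not_neutral_contains_not_neutral) blast
  moreover have "z = rvec I + rvec (K - I)"
    by (simp add: K rvec_diff)
  ultimately show "z \<in> {x + y |x y. x \<in> supp f \<and> y \<in> supp g}"
    unfolding supp_def by blast
qed

lemma supp_sum: "supp (\<lambda>I. \<Sum>a\<in>A. f a I) \<subseteq> (\<Union>a\<in>A. supp (f a))"
proof
  fix z assume "z \<in> supp (\<lambda>I. \<Sum>a\<in>A. f a I)"
  then obtain I where I: "z = rvec I" "(\<Sum>a\<in>A. f a I) \<noteq> 0"
    unfolding supp_def by blast
  from I(2) obtain a where "a \<in> A" "f a I \<noteq> 0"
    by (rule sum.not_neutral_contains_not_neutral)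
  then show "z \<in> (\<Union>a\<in>A. supp (f a))"
    unfolding supp_def I(1) by blast
qed

lemma supp_ser_monom: "supp (ser_monom c I) \<subseteq> {rvec I}"
  unfolding supp_def ser_monom_def by auto

text \<open>Any additive monoid containing the support of \<open>g\<close> bounds all powers
  uniformly in \<open>n\<close>, as is required for the geometric series.\<close>

lemma supp_ser_power:
  assumes "supp g \<subseteq> S" "0 \<in> S" "\<And>x y. x \<in> S \<Longrightarrow> y \<in> S \<Longrightarrow> x + y \<in> S"
  shows "supp (ser_power g n) \<subseteq> S"
proof (induction n)
  case 0
  then show ?case using supp_ser_monom[of 1 0] assms(2) by (auto simp: rvec_zero)
next
  case (Suc n)
  then show ?case using supp_ser_mult[of g "ser_power g n"] assms(1,3) by fastforce
qed

section \<open>Closure of the field of series under the ring operations\<close>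

context
  fixes w :: "real ^ 'n" and leq
  assumes w: "induces_order w leq"
begin

lemma ser_mult_in_series_field:
  assumes "f \<in> series_field leq" "g \<in> series_field leq"
  shows "ser_mult f g \<in> series_field leq"
  using assms admissible_subset[OF admissible_plus supp_ser_mult]
  unfolding series_field_iff_admissible[OF w] by blast

lemma ser_monom_in_series_field: "ser_monom c I \<in> series_field leq"
  unfolding series_field_iff_admissible[OF w]
  using admissible_subset[OF admissible_rvec supp_ser_monom] .

lemma ser_power_in_series_field:
  assumes "g \<in> series_field leq"
  shows "ser_power g n \<in> series_field leq"
  by (induction n) (auto intro: ser_mult_in_series_field ser_monom_in_series_field assms)

lemma smult_in_series_field:
  assumes "g \<in> series_field leq"
  shows "(\<lambda>I. c * g I) \<in> series_field leq"
proof -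
  have "supp (\<lambda>I. c * g I) \<subseteq> supp g"
    unfolding supp_def by auto
  then show ?thesis
    using assms admissible_subset unfolding series_field_iff_admissible[OF w] by blast
qed

lemma sum_in_series_field:
  assumes "\<And>a. a \<in> A \<Longrightarrow> f a \<in> series_field leq"
  shows "(\<lambda>I. \<Sum>a\<in>A. f a I) \<in> series_field leq"
proof (cases "finite A")
  case True
  then have "admissible w (\<Union>a\<in>A. supp (f a))"
    using assms unfolding series_field_iff_admissible[OF w]
    by (induction A) (auto intro: admissible_Un[OF w] admissible_empty)
  then show ?thesis
    unfolding series_field_iff_admissible[OF w] using supp_sum by (rule admissible_subset)
next
  \<comment> \<open>For infinite \<open>A\<close> the sum is 0 by convention, so the support is
    empty.\<close>
  case False
  then show ?thesis
    unfolding series_field_iff_admissible[OF w] by (simp add: supp_def admissible_empty)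
qed

end

section \<open>Polynomials and rational functions as series\<close>

lemma ser_mult_monom: "ser_mult f (ser_monom c I) K = c * f (K - I)"
proof -
  have "ser_mult f (ser_monom c I) K = (\<Sum>J | f J \<noteq> 0 \<and> c \<noteq> 0 \<and> K - J = I. f J * c)"
    unfolding ser_mult_def ser_monom_def by (intro sum.cong) auto
  also have "{J. f J \<noteq> 0 \<and> c \<noteq> 0 \<and> K - J = I} = (if f (K - I) \<noteq> 0 \<and> c \<noteq> 0 then {K - I} else {})"
    by (auto simp: algebra_simps)
  finally show ?thesis by auto
qed

lemma finite_bicoeff: "finite {(i, j). bicoeff p i j \<noteq> 0}"
proof (rule finite_subset)
  let ?B = "\<Union>j\<le>Polynomial.degree p. {..Polynomial.degree (Polynomial.coeff p j)} \<times> {j}"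
  show "{(i, j). bicoeff p i j \<noteq> 0} \<subseteq> ?B"
  proof clarify
    fix i j assume ij: "bicoeff p i j \<noteq> 0"
    then have "Polynomial.coeff p j \<noteq> 0"
      unfolding bicoeff_def by auto
    with ij show "(i, j) \<in> ?B"
      unfolding bicoeff_def by (auto intro: le_degree)
  qed
  show "finite ?B" by auto
qed

lemma ser_of_bipoly_support:
  "{I. ser_of_bipoly p I \<noteq> 0} = (\<lambda>(i, j). vector [of_nat i, of_nat j]) ` {(i, j). bicoeff p i j \<noteq> 0}"
proof
  show "{I. ser_of_bipoly p I \<noteq> 0} \<subseteq> (\<lambda>(i, j). vector [of_nat i, of_nat j]) ` {(i, j). bicoeff p i j \<noteq> 0}"
  proof
    fix I assume "I \<in> {I. ser_of_bipoly p I \<noteq> 0}"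
    then have "I $ 1 \<in> \<nat>" "I $ 2 \<in> \<nat>" "bicoeff p (nat \<lfloor>I $ 1\<rfloor>) (nat \<lfloor>I $ 2\<rfloor>) \<noteq> 0"
      unfolding ser_of_bipoly_def by (auto split: if_splits)
    moreover from this have "I = vector [of_nat (nat \<lfloor>I $ 1\<rfloor>), of_nat (nat \<lfloor>I $ 2\<rfloor>)]"
      by (auto simp: vec_eq_iff forall_2 elim!: Nats_cases)
    ultimately show "I \<in> (\<lambda>(i, j). vector [of_nat i, of_nat j]) ` {(i, j). bicoeff p i j \<noteq> 0}"
      by (intro image_eqI[of _ _ "(nat \<lfloor>I $ 1\<rfloor>, nat \<lfloor>I $ 2\<rfloor>)"]) auto
  qed
qed (auto simp: ser_of_bipoly_def)

lemma supp_ser_of_bipoly_Ints: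
  fixes z :: "real ^ 2"
  assumes "z \<in> supp (ser_of_bipoly p)"
  shows "z $ i \<in> \<int>"
proof -
  have "\<forall>i. z $ i \<in> \<int>"
    using assms unfolding supp_def ser_of_bipoly_support forall_2 by (auto simp: rvec_def)
  then show ?thesis ..
qed

lemma finite_supp_ser_of_bipoly: "finite (supp (ser_of_bipoly p))"
  unfolding supp_def ser_of_bipoly_support using finite_bicoeff by auto

lemma ser_of_bipoly_nonzero:
  assumes "q \<noteq> 0"
  shows "ser_of_bipoly q \<noteq> ser_zero"
proof -
  obtain j where "Polynomial.coeff q j \<noteq> 0"
    using leading_coeff_neq_0[OF assms] by blast
  then obtain i where "bicoeff q i j \<noteq> 0"
    unfolding bicoeff_def using leading_coeff_neq_0 by blast
  then have "{I. ser_of_bipoly q I \<noteq> 0} \<noteq> {}"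
    unfolding ser_of_bipoly_support by auto
  then show ?thesis
    unfolding ser_zero_def by auto
qed

lemma ser_of_bipoly_in_series_field:
  assumes "induces_order w leq"
  shows "ser_of_bipoly p \<in> series_field leq"
  unfolding series_field_iff_admissible[OF assms] supp_def ser_of_bipoly_support
  by (intro admissible_finite[OF assms] finite_imageI finite_bicoeff)

lemma leading_exp_is_leading_exp:
  assumes "induces_order w leq" "is_leading_exp leq g I"
  shows "leading_exp leq g = I"
  unfolding leading_exp_def
  using assms by (intro the_equality) (auto simp: is_leading_exp_def induces_order_def)

text \<open>The exponents of 1 - q / lt(q) are differences \<open>J - I\<close> with
  \<open>J\<close> strictly below the leading exponent \<open>I\<close>. There are finitely many of
  them, all integral and negative with respect to \<open>w\<close>, so the lattice points of the
  cone they generate form an admissible set containing the support of the geometric series.\<close>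

lemma expand_frac_in_series_field:
  assumes w: "induces_order w leq" and q: "q \<noteq> 0"
  shows "expand_frac leq p q \<in> series_field leq"
proof -
  define Q where "Q = ser_of_bipoly q"
  define I where "I = leading_exp leq Q"
  define lt_inv where "lt_inv = ser_monom (1 / Q I) (- I)"
  define h where "h = ser_diff (ser_monom 1 0) (ser_mult Q lt_inv)"
  have I: "is_leading_exp leq Q I"
    using admissible_max[OF w _ ser_of_bipoly_nonzero[OF q]] ser_of_bipoly_in_series_field[OF w]
      leading_exp_is_leading_exp[OF w]
    unfolding series_field_iff_admissible[OF w] I_def Q_def by blast
  have h_eq: "h K = (if K = 0 then 1 else 0) - Q (K + I) / Q I" for K
    unfolding h_def lt_inv_def ser_diff_def ser_mult_monom by (simp add: ser_monom_def)
  \<comment> \<open>The support of \<open>h\<close> itself serves as the set of generators.\<close>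
  define V where "V = supp h"
  have V_elem: "\<exists>J. x = rvec (J - I) \<and> Q J \<noteq> 0 \<and> J \<noteq> I" if x: "x \<in> V" for x
  proof -
    obtain K where K: "x = rvec K" "h K \<noteq> 0"
      using x unfolding V_def supp_def by blast
    have "Q I \<noteq> 0"
      using I unfolding is_leading_exp_def by blast
    \<comment> \<open>At exponent 0 the leading term of the normalized denominator cancels against
      1.\<close>
    then have "K \<noteq> 0"
      using K(2) unfolding h_eq by auto
    moreover from this have "Q (K + I) \<noteq> 0"
      using K(2) unfolding h_eq by auto
    ultimately show ?thesis
      using K(1) by (intro exI[of _ "K + I"]) auto
  qed
  have V_neg: "x \<bullet> w < 0" if "x \<in> V" for x
  proof -
    obtain J where J: "x = rvec (J - I)" "Q J \<noteq> 0" "J \<noteq> I"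
      using V_elem \<open>x \<in> V\<close> by blast
    then have "leq J I"
      using I unfolding is_leading_exp_def by blast
    then have "leq (J - I) 0"
      using w unfolding induces_order_def by (simp add: rvec_diff rvec_zero inner_diff_left)
    then show ?thesis
      using induces_order_neg[OF w, of "J - I"] J by simp
  qed
  have V_Ints: "x $ i \<in> \<int>" if "x \<in> V" for x :: "real ^ 2" and i
  proof -
    obtain J where J: "x = rvec J - rvec I" "Q J \<noteq> 0"
      using V_elem \<open>x \<in> V\<close> by (auto simp: rvec_diff)
    moreover have "Q I \<noteq> 0"
      using I unfolding is_leading_exp_def by blast
    ultimately have "rvec J \<in> supp Q" "rvec I \<in> supp Q"
      unfolding supp_def by blast+
    then show ?thesis
      using J(1) supp_ser_of_bipoly_Ints[of _ q i] unfolding Q_def by simp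
  qed
  have "V \<subseteq> (\<lambda>z. z - rvec I) ` supp Q"
    using V_elem by (force simp: supp_def rvec_diff)
  then have V_fin: "finite V"
    using finite_supp_ser_of_bipoly unfolding Q_def by (meson finite_imageI finite_subset)
  \<comment> \<open>Integrality is carried along with the cone: both conditions survive addition, so
    one set bounds all powers with denominator 1.\<close>
  let ?S = "{z :: real ^ 2. z \<in> generated_cone V \<and> (\<forall>i. z $ i \<in> \<int>)}"
  have "supp (ser_power h n) \<subseteq> ?S" for n
  proof (rule supp_ser_power)
    show "supp h \<subseteq> ?S"
      using V_Ints generated_cone_superset[OF V_fin] unfolding V_def by blast
  qed (auto simp: generated_cone_zero generated_cone_add)
  \<comment> \<open>An infinite index set would give the default value 0, so a nonzero coefficient
    always comes from a nonzero summand.\<close>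
  moreover have "supp (formal_sum (ser_power h)) \<subseteq> (\<Union>n. supp (ser_power h n))"
    unfolding supp_def formal_sum_def
    by (auto elim!: sum.not_neutral_contains_not_neutral)
  ultimately have "supp (formal_sum (ser_power h)) \<subseteq> ?S"
    by blast
  moreover have "admissible w ?S"
    unfolding admissible_def using V_fin V_neg V_Ints Ints_subset_Rats
    by (intro exI[of _ 0] exI[of _ V] exI[of _ 1]) auto
  ultimately have "formal_sum (ser_power h) \<in> series_field leq"
    unfolding series_field_iff_admissible[OF w] using admissible_subset by blast
  then have "ser_mult (ser_mult (ser_of_bipoly p) lt_inv) (formal_sum (ser_power h)) \<in> series_field leq"
    unfolding lt_inv_def
    by (intro ser_mult_in_series_field[OF w] ser_of_bipoly_in_series_field[OF w]
        ser_monom_in_series_field[OF w])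
  then show ?thesis
    unfolding expand_frac_def Let_def h_def lt_inv_def I_def Q_def .
qed

text \<open>The choice operator picks a fraction with nonzero denominator, and the previous lemma
  covers each such fraction.\<close>

lemma expand_in_series_field:
  assumes "induces_order w leq"
  shows "expand leq r \<in> series_field leq"
proof -
  have "\<exists>g p q. q \<noteq> 0 \<and> r = Fract p q \<and> g = expand_frac leq p q"
    by (cases r) auto
  then have "\<exists>p q. q \<noteq> 0 \<and> r = Fract p q \<and> expand leq r = expand_frac leq p q"
    unfolding expand_def by (rule someI_ex)
  then show ?thesis
    using expand_frac_in_series_field[OF assms] by auto
qed

lemma ser_eval_in_series_field:
  assumes "induces_order w leq" "\<phi> \<in> series_field leq"
  shows "ser_eval leq p \<phi> \<in> series_field leq"
  unfolding ser_eval_def using assms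
  by (intro sum_in_series_field ser_mult_in_series_field ser_power_in_series_field
      expand_in_series_field)

lemma term_series_in_tseries_ring:
  assumes "induces_order w leq" "\<phi> \<in> series_field leq"
  shows "term_series leq \<phi> F p \<in> tseries_ring leq"
proof -
  obtain p1 p2 p3 where "p = (p1, p2, p3)"
    by (cases p)
  moreover have "subst_xy F g1 g2 n \<in> series_field leq"
    if "g1 \<in> series_field leq" "g2 \<in> series_field leq" for g1 g2 n
    unfolding subst_xy_def case_prod_beta using assms(1) that
    by (intro sum_in_series_field smult_in_series_field ser_mult_in_series_field
        ser_power_in_series_field)
  ultimately show ?thesis
    unfolding term_series_def tseries_ring_def tser_scale_def using assms
    by (auto intro!: ser_mult_in_series_field ser_eval_in_series_field)
qed

section \<open>Correctness of the algorithm\<close>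

text \<open>The exponent in three variables that belongs to the exponent \<open>z\<close> in the
  coefficient of the \<open>n\<close>-th power of t.\<close>

definition lift_t :: "nat \<Rightarrow> real ^ 2 \<Rightarrow> real ^ 3" where
  "lift_t n z = emb z + vector [0, 0, of_nat n]"

lemma emb_add: "emb (x + y) = emb x + emb y"
  by (simp add: emb_def vec_eq_iff forall_3)

lemma emb_scaleR: "emb (r *\<^sub>R x) = r *\<^sub>R emb x"
  by (simp add: emb_def vec_eq_iff forall_3)

text \<open>\<open>vector\<close> lists the rows of a matrix; after transposition the three vectors
  are its columns.\<close>

lemma composition_matrix_mult:
  "(transpose (vector [emb v1, emb v2, vector [0, 0, 1]]) :: real ^ 3 ^ 3) *v vector [i, j, n] =
   i *\<^sub>R emb v1 + j *\<^sub>R emb v2 + vector [0, 0, n]"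
  by (simp add: vec_eq_iff forall_3 matrix_vector_mult_def transpose_def sum_3 mult.commute)

text \<open>The apex is added \<open>n\<close> times, while the cone parts stay in \<open>D\<close>,
  which is closed under addition. Keeping the apex explicit lets its multiples be collected into a
  matrix image later.\<close>

lemma supp_ser_power_cone:
  assumes "supp g \<subseteq> (+) v ` D" "strictly_convex D"
  shows "supp (ser_power g n) \<subseteq> (+) (of_nat n *\<^sub>R v) ` D"
proof (induction n)
  case 0
  then show ?case
    using supp_ser_monom[of 1 0] strictly_convex_zero[OF assms(2)] by (auto simp: rvec_zero)
next
  case (Suc n)
  show ?case
  proof
    fix z assume "z \<in> supp (ser_power g (Suc n))"
    then obtain x y where "z = x + y" "x \<in> supp g" "y \<in> supp (ser_power g n)"
      using supp_ser_mult by fastforce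
    then obtain c d where "z = (v + c) + (of_nat n *\<^sub>R v + d)" "c \<in> D" "d \<in> D"
      using Suc assms(1) by blast
    then show "z \<in> (+) (of_nat (Suc n) *\<^sub>R v) ` D"
      by (intro image_eqI[of _ _ "c + d"])
        (auto simp: algebra_simps convex_cone_add[OF assms(2)])
  qed
qed

text \<open>This is the support estimate of the composition theorem, with the estimated vertices in
  place of leading exponents. It suffices to treat one monomial of \<open>F\<close> at a
  time.\<close>

lemma supp_subst_xy_composition_cone:
  assumes comp: "composition_cone C1 (v1, D1) (v2, D2) C'" and F: "supp_xyt F \<subseteq> C1"
    and g1: "supp g1 \<subseteq> (+) v1 ` D1" "strictly_convex D1"
    and g2: "supp g2 \<subseteq> (+) v2 ` D2" "strictly_convex D2"
    and z: "z \<in> supp (subst_xy F g1 g2 n)"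
  shows "lift_t n z \<in> C'"
proof -
  let ?M = "transpose (vector [emb v1, emb v2, vector [0, 0, 1]]) :: real ^ 3 ^ 3"
  have C': "strictly_convex C'" "(\<lambda>z. ?M *v z) ` C1 \<subseteq> C'" "emb ` D1 \<subseteq> C'" "emb ` D2 \<subseteq> C'"
    using comp unfolding composition_cone_def Let_def by auto
  obtain I where I: "z = rvec I" "subst_xy F g1 g2 n I \<noteq> 0"
    using z unfolding supp_def by blast
  from I(2) obtain i j where ij: "bicoeff (fps_nth F n) i j \<noteq> 0"
    "z \<in> supp (ser_mult (ser_power g1 i) (ser_power g2 j))"
    unfolding subst_xy_def I(1) supp_def
    by (elim sum.not_neutral_contains_not_neutral) auto
  then obtain x y where xy: "z = x + y" "x \<in> supp (ser_power g1 i)" "y \<in> supp (ser_power g2 j)"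
    using supp_ser_mult by blast
  then obtain c d where cd: "x = of_nat i *\<^sub>R v1 + c" "c \<in> D1" "y = of_nat j *\<^sub>R v2 + d" "d \<in> D2"
    using supp_ser_power_cone[OF g1] supp_ser_power_cone[OF g2] by blast
  have "vector [of_nat i, of_nat j, of_nat n] \<in> C1"
    using F ij(1) unfolding supp_xyt_def by blast
  then have "?M *v vector [of_nat i, of_nat j, of_nat n] \<in> C'"
    using C'(2) by blast
  moreover have "emb c \<in> C'" "emb d \<in> C'"
    using C'(3,4) cd by auto
  \<comment> \<open>The multiples of the two apices and the exponent of t make up the image of a
    point of \<open>C1\<close>; \<open>c\<close> and \<open>d\<close> are what remains.\<close>
  moreover have "lift_t n z = ?M *v vector [of_nat i, of_nat j, of_nat n] + (emb c + emb d)"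
    unfolding composition_matrix_mult lift_t_def xy(1) cd(1,3) emb_add emb_scaleR by simp
  ultimately show ?thesis
    by (simp add: convex_cone_add[OF C'(1)])
qed

text \<open>The estimates of \<open>step3\<close> bound entire supports, so a nonzero term in the
  quadrant would have its exponent among those checked in \<open>step4\<close>.\<close>

lemma step4_nonneg_part:
  assumes step3: "step3 \<phi> C0 L0 C leq Lp" and step4: "step4 \<phi> C1 F L0 leq Lp K"
    and F: "supp_xyt F \<subseteq> C1" and p: "p \<in> set L0"
  shows "nonneg_part (term_series leq \<phi> F p) = (\<lambda>n. ser_zero)"
proof -
  obtain p1 p2 p3 where p_eq: "p = (p1, p2, p3)"
    by (cases p)
  have comps: "p1 \<in> components L0" "p2 \<in> components L0" "p3 \<in> components L0"
    using p unfolding p_eq components_def by force+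
  obtain e1 e2 v3 D3 where e: "e1 \<in> set (Lp p1)" "e2 \<in> set (Lp p2)" "(v3, D3) \<in> set (Lp p3)"
    "composition_cone C1 e1 e2 (K e1 e2)"
    and zero: "\<And>J. 0 \<le> J $ 1 \<Longrightarrow> 0 \<le> J $ 2 \<Longrightarrow>
      rvec J \<in> (+) (emb v3) ` minkowski_sum (emb ` D3) (K e1 e2) \<Longrightarrow>
      coeff_xyt (term_series leq \<phi> F (p1, p2, p3)) J = 0"
    using step4 p unfolding step4_def p_eq Let_def by fastforce
  obtain v1 D1 v2 D2 where e_eq: "e1 = (v1, D1)" "e2 = (v2, D2)"
    by (cases e1, cases e2)
  have est: "supp (ser_eval leq q \<phi>) \<subseteq> (+) v ` D" "strictly_convex D"
    if "q \<in> components L0" "(v, D) \<in> set (Lp q)" for q v D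
    using step3 that unfolding step3_def by blast+
  have "term_series leq \<phi> F p n I = 0" if I: "0 \<le> I $ 1" "0 \<le> I $ 2" for n and I :: "rat ^ 2"
  proof (rule ccontr)
    assume "term_series leq \<phi> F p n I \<noteq> 0"
    then have "rvec I \<in> supp (ser_mult (ser_eval leq p3 \<phi>)
        (subst_xy F (ser_eval leq p1 \<phi>) (ser_eval leq p2 \<phi>) n))"
      unfolding p_eq term_series_def tser_scale_def supp_def by auto
    then obtain x y where xy: "rvec I = x + y" "x \<in> supp (ser_eval leq p3 \<phi>)"
      "y \<in> supp (subst_xy F (ser_eval leq p1 \<phi>) (ser_eval leq p2 \<phi>) n)"
      using supp_ser_mult by blast
    obtain d where d: "d \<in> D3" "x = v3 + d"
      using est(1)[OF comps(3) e(3)] xy(2) by blast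
    have y: "lift_t n y \<in> K e1 e2"
      unfolding e_eq
      by (rule supp_subst_xy_composition_cone[OF e(4)[unfolded e_eq] F
            est[OF comps(1) e(1)[unfolded e_eq]] est[OF comps(2) e(2)[unfolded e_eq]] xy(3)])
    \<comment> \<open>\<open>step4\<close> checks exponents in three variables. The third component
      is a natural number, so \<open>coeff_xyt\<close> reads off the coefficient of \<open>I\<close>
      at \<open>n\<close>.\<close>
    define J :: "rat ^ 3" where "J = vector [I $ 1, I $ 2, of_nat n]"
    have "rvec J = lift_t n (rvec I)"
      by (simp add: J_def lift_t_def emb_def rvec_def vec_eq_iff forall_3)
    \<comment> \<open>The whole exponent of t goes to the factor coming from \<open>F\<close>, since
      \<open>p3\<close> contributes only in the plane.\<close>
    also have "\<dots> = emb v3 + (emb d + lift_t n y)"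
      unfolding xy(1) d(2) lift_t_def emb_add by simp
    also have "\<dots> \<in> (+) (emb v3) ` minkowski_sum (emb ` D3) (K e1 e2)"
      using d(1) y unfolding minkowski_sum_def by blast
    finally have "coeff_xyt (term_series leq \<phi> F p) J = 0"
      using zero I unfolding p_eq J_def by simp
    moreover have "vector [I $ 1, I $ 2] = I"
      by (simp add: vec_eq_iff forall_2)
    ultimately show False
      using \<open>term_series leq \<phi> F p n I \<noteq> 0\<close> unfolding coeff_xyt_def J_def by simp
  qed
  then show ?thesis
    unfolding nonneg_part_def ser_zero_def by (intro ext) auto
qed

text \<open>\<open>skip\<close> and \<open>continue\<close> pass the answer on unchanged and
  \<open>finished\<close> yields \<open>Failed\<close>, so the answer must originate in a use of
  \<open>succeed\<close>. The answer is kept as a variable for the induction.\<close>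

lemma loop_Returned_True:
  assumes "loop \<phi> C0 C1 F L0 L1 a" "a = Returned_True"
  obtains C leq Lp K where "step3 \<phi> C0 L0 C leq Lp" "step4 \<phi> C1 F L0 leq Lp K"
  using assms by (induction) auto

theorem theorem5:
  fixes m :: "ratfun poly" and \<alpha> :: "ratfun alg_closure" and \<phi> :: "2 series"
    and C0 :: "(real ^ 2) set" and C1 :: "(real ^ 3) set"
    and F :: "bipoly fps" and L0 :: "(ratfun poly \<times> ratfun poly \<times> ratfun poly) list"
  assumes "is_minimal_poly m \<alpha>"
    and "series_root m \<phi>"
    and "is_cone C0" and "rec_cone (newt \<phi>) \<subseteq> C0"
    and "is_cone C1" and "supp_xyt F \<subseteq> C1" and "C1 \<inter> range emb = {0}"
    and "\<forall>p \<in> components L0. \<forall>i. Polynomial.coeff p i \<in> ratfun_over_rat"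
    and "algorithm_A \<phi> C0 C1 F L0 Returned_True"
  shows "\<exists>leq. additive_total_order leq \<and> \<phi> \<in> series_field leq \<and>
    (\<forall>p \<in> set L0. term_series leq \<phi> F p \<in> tseries_ring leq \<and>
       nonneg_part (term_series leq \<phi> F p) = (\<lambda>n. ser_zero))"
proof -
  obtain C leq Lp K where steps: "step3 \<phi> C0 L0 C leq Lp" "step4 \<phi> C1 F L0 leq Lp K"
    using assms(9) loop_Returned_True unfolding algorithm_A_def by metis
  then obtain w where w: "induces_order w leq" and \<phi>: "\<phi> \<in> series_field leq"
    unfolding step3_def by blast
  then show ?thesis
    using step4_nonneg_part[OF steps assms(6)] term_series_in_tseries_ring[OF w \<phi>]
    unfolding additive_total_order_def by blast
qed

end
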